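(* Let $G$ be an edge-colored graph on $n$ vertices. If $d^{c}(v)\geq n/2$ for every vertex $v\in V(G)$ and $G$ contains no rainbow triangles, then either $n$ is even and $G$ is (as an uncolored graph, up to isomorphism) the complete bipartite graph $K_{n/2,n/2}$, or $n=4$ and $G$ is (as an uncolored graph, up to isomorphism) $K_4-e$ or $K_4$.
   Context: All graphs are simple and finite. An edge-colored graph is a graph $G=(V,E)$ together with an arbitrary mapping $C:E\to\mathbb{N}$ (not required to be a proper edge-coloring). For a vertex $v$ of $G$, the color degree $d^c(v)$ is the number of distinct colors appearing on the edges incident to $v$. A rainbow triangle is a triangle of $G$ whose three edges have pairwise distinct colors. $K_4-e$ denotes the complete graph $K_4$ with one edge deleted. *)

theory Defs
  imports Complex_Main "HOL-Library.Ramsey"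
begin

text \<open>A graph is a pair of a vertex set and a set of two-element sets of vertices.\<close>

type_synonym 'a graph = "'a set \<times> 'a set set"

definition simple_graph :: "'a graph \<Rightarrow> bool" where
  "simple_graph = (\<lambda>(V, E). finite V \<and> E \<subseteq> [V]\<^bsup>2\<^esup>)"

definition graph_iso :: "'a graph \<Rightarrow> 'b graph \<Rightarrow> bool" (infix \<open>\<simeq>\<^sub>g\<close> 50) where
  "G \<simeq>\<^sub>g H \<longleftrightarrow> (\<exists>f. bij_betw f (fst G) (fst H) \<and>
     (\<forall>u\<in>fst G. \<forall>v\<in>fst G. {u, v} \<in> snd G \<longleftrightarrow> {f u, f v} \<in> snd H))"

definition complete_graph :: "nat \<Rightarrow> nat graph" where
  "complete_graph n = ({..<n}, [{..<n}]\<^bsup>2\<^esup>)"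

definition complete_bipartite_graph :: "nat \<Rightarrow> nat \<Rightarrow> (nat + nat) graph" where
  "complete_bipartite_graph a b =
     ({..<a} <+> {..<b}, {{Inl i, Inr j} | i j. i < a \<and> j < b})"

definition K4_minus_edge :: "nat graph" where
  "K4_minus_edge = (fst (complete_graph 4), snd (complete_graph 4) - {{0, 1}})"

text \<open>An edge coloring is a function on sets of vertices; only its values on edges matter.\<close>

definition color_degree :: "'a graph \<Rightarrow> ('a set \<Rightarrow> nat) \<Rightarrow> 'a \<Rightarrow> nat" where
  "color_degree G C v = card (C ` {e \<in> snd G. v \<in> e})"

text \<open>No distinctness of \<open>x\<close>, \<open>y\<close>, \<open>z\<close> is required below, as edges of a simple graph have two endpoints.\<close>

definition has_rainbow_triangle :: "'a graph \<Rightarrow> ('a set \<Rightarrow> nat) \<Rightarrow> bool" where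
  "has_rainbow_triangle G C \<longleftrightarrow> (\<exists>x y z.
     {x, y} \<in> snd G \<and> {y, z} \<in> snd G \<and> {x, z} \<in> snd G \<and>
     C {x, y} \<noteq> C {y, z} \<and> C {y, z} \<noteq> C {x, z} \<and> C {x, y} \<noteq> C {x, z})"

end

theory Submission
  imports Defs
begin

text \<open>
  Let \<open>d(v)\<close> be the degree, \<open>c(v)\<close> the color degree and \<open>e(v) = d(v) - c(v)\<close>. Adjacent vertices
  \<open>v\<close>, \<open>w\<close> have at least \<open>d(v) + d(w) - n\<close> common neighbors, so there are at least
  \<open>\<Sum>v. d(v) (2 d(v) - n) \<ge> \<Sum>v. 2 d(v) e(v)\<close> ordered triangles. As no triangle is rainbow, each has
  two edges of the same color at some vertex, and a vertex lies on at most \<open>e(v) (e(v) + 1)\<close> ordered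
  pairs of such edges. Hence \<open>\<Sum>v. e(v) (2 d(v) - 3 e(v) - 3) \<le> 0\<close>. If \<open>n \<noteq> 4\<close>, the second
  factor is positive whenever \<open>e(v) > 0\<close>, so \<open>e = 0\<close>: the coloring is proper, every triangle would be
  rainbow, and a triangle-free graph of minimum degree at least \<open>n/2\<close> is \<open>K\<^bsub>n/2,n/2\<^esub>\<close>. For \<open>n = 4\<close>
  minimum degree 2 alone suffices.
\<close>

section \<open>Neighborhoods and color degrees\<close>

definition nbhd :: "'a set set \<Rightarrow> 'a \<Rightarrow> 'a set" where
  "nbhd E v = {w. {v, w} \<in> E}"

text \<open>Triples are ordered, so a triangle of a simple graph counts six times; its vertices are
  distinct because there are no loops.\<close>

definition triangles :: "'a set set \<Rightarrow> ('a \<times> 'a \<times> 'a) set" where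
  "triangles E = {(x, y, z). {x, y} \<in> E \<and> {y, z} \<in> E \<and> {x, z} \<in> E}"

lemma in_nbhd [simp]: "w \<in> nbhd E v \<longleftrightarrow> {v, w} \<in> E"
  by (simp add: nbhd_def)

lemma simple_graph_edgeD:
  assumes "simple_graph (V, E)" "{u, v} \<in> E"
  shows "u \<in> V" "v \<in> V" "u \<noteq> v"
proof -
  have "{u, v} \<subseteq> V" "card {u, v} = 2"
    using assms by (auto simp: simple_graph_def nsets_def)
  then show "u \<in> V" "v \<in> V" "u \<noteq> v" by auto
qed

lemma nbhd_subset: "simple_graph (V, E) \<Longrightarrow> nbhd E v \<subseteq> V - {v}"
proof
  fix w assume "simple_graph (V, E)" "w \<in> nbhd E v"
  then show "w \<in> V - {v}" using simple_graph_edgeD[of V E v w] by auto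
qed

lemma simple_graph_finite: "simple_graph (V, E) \<Longrightarrow> finite V"
  by (simp add: simple_graph_def)

lemma finite_nbhd: "simple_graph (V, E) \<Longrightarrow> finite (nbhd E v)"
  by (meson finite_Diff finite_subset nbhd_subset simple_graph_finite)

lemma card_nbhd_less:
  assumes "simple_graph (V, E)" "v \<in> V"
  shows "card (nbhd E v) < card V"
  by (rule psubset_card_mono) (use assms nbhd_subset[OF assms(1), of v] in
      \<open>auto dest: simple_graph_finite\<close>)

text \<open>Every edge at \<open>v\<close> arises from a neighbor, so color degrees become image
  sizes of functions on neighborhoods, ready for the counting of fibers.\<close>

lemma color_degree_nbhd:
  assumes "simple_graph (V, E)"
  shows "color_degree (V, E) C v = card ((\<lambda>w. C {v, w}) ` nbhd E v)"
proof -
  have "\<exists>w. e = {v, w}" if e: "e \<in> E" "v \<in> e" for e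
  proof -
    have "card e = 2" using assms e by (auto simp: simple_graph_def nsets_def)
    then show ?thesis using e(2) by (auto simp: card_2_iff)
  qed
  then have "{e \<in> E. v \<in> e} = (\<lambda>w. {v, w}) ` nbhd E v"
    by (fastforce simp: image_iff)
  then show ?thesis by (simp add: color_degree_def image_image)
qed

lemma color_degree_le_card_nbhd:
  assumes "simple_graph (V, E)"
  shows "color_degree (V, E) C v \<le> card (nbhd E v)"
  unfolding color_degree_nbhd[OF assms] by (rule card_image_le[OF finite_nbhd[OF assms]])

section \<open>Colliding pairs of a function on a finite set\<close>

text \<open>All values other than \<open>a\<close> come from elements outside the fiber, so the
  image exceeds their number by at most one.\<close>

lemma card_fiber_le:
  assumes "finite N"
  shows "card {u \<in> N. f u = a} + card (f ` N) \<le> Suc (card N)"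
proof -
  let ?F = "{u \<in> N. f u = a}"
  have "f ` N \<subseteq> insert a (f ` (N - ?F))" by auto
  then have "card (f ` N) \<le> card (insert a (f ` (N - ?F)))"
    using assms by (intro card_mono) auto
  also have "\<dots> \<le> Suc (card (f ` (N - ?F)))"
    using assms by (simp add: card_insert_if)
  also have "\<dots> \<le> Suc (card (N - ?F))"
    using assms by (simp add: card_image_le)
  also have "card (N - ?F) = card N - card ?F"
    using assms by (intro card_Diff_subset) auto
  finally show ?thesis
    using card_mono[OF assms, of ?F] by auto
qed

text \<open>Induction on \<open>N\<close>, with \<open>e\<close> the excess of elements over values.
  An element with a new value adds no pair and keeps \<open>e\<close>. One with an old value raises
  \<open>e\<close> by one and adds two ordered pairs for each of the at most \<open>e + 1\<close>
  earlier elements with that value.\<close>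

lemma card_colliding_pairs_le:
  fixes f :: "'a \<Rightarrow> 'b"
  assumes "finite N"
  shows "card {(u, w). u \<in> N \<and> w \<in> N \<and> u \<noteq> w \<and> f u = f w}
    \<le> (card N - card (f ` N)) * (card N - card (f ` N) + 1)"
  using assms
proof (induction N)
  case empty
  then show ?case by simp
next
  case (insert x N)
  let ?P = "\<lambda>N. {(u, w). u \<in> N \<and> w \<in> N \<and> u \<noteq> w \<and> f u = f w}"
  let ?F = "{u \<in> N. f u = f x}"
  let ?e = "card N - card (f ` N)"
  have fin: "finite (?P N)"
    by (rule finite_subset[of _ "N \<times> N"]) (use insert in auto)
  have "?P (insert x N) = ?P N \<union> (Pair x ` ?F \<union> (\<lambda>u. (u, x)) ` ?F)"
    using insert(2) by auto
  then have "card (?P (insert x N)) \<le> card (?P N) + (card (Pair x ` ?F) + card ((\<lambda>u. (u, x)) ` ?F))"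
    by (metis (no_types, lifting) add_left_mono card_Un_le le_trans)
  also have "\<dots> \<le> card (?P N) + (card ?F + card ?F)"
    using insert(1) by (intro add_mono card_image_le order.refl) auto
  finally have step: "card (?P (insert x N)) \<le> card (?P N) + 2 * card ?F" by simp
  have F: "card ?F \<le> Suc ?e"
    using card_fiber_le[OF insert(1), of f "f x"] card_image_le[OF insert(1), of f] by linarith
  show ?case
  proof (cases "f x \<in> f ` N")
    case True
    then have eq: "card (insert x N) - card (f ` insert x N) = Suc ?e"
      using insert(1,2) card_image_le[OF insert(1), of f] by (simp add: insert_absorb Suc_diff_le)
    \<comment> \<open>The bounds add up exactly:
      \<open>e (e + 1) + 2 (e + 1) = (e + 1) (e + 2)\<close>.\<close>
    have "card (?P N) + 2 * card ?F \<le> Suc ?e * (Suc ?e + 1)"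
      using insert.IH F by simp
    then show ?thesis unfolding eq by (rule order.trans[OF step])
  next
    case False
    then have empty: "?F = {}" by (auto simp: image_iff)
    have "card ?F = 0" unfolding empty by simp
    then have le: "card (?P (insert x N)) \<le> card (?P N)" using step by linarith
    have eq: "card (insert x N) - card (f ` insert x N) = ?e"
      using insert(1,2) False by simp
    show ?thesis unfolding eq by (rule order.trans[OF le insert.IH])
  qed
qed

section \<open>Lower bound for the number of triangles\<close>

lemma finite_triangles:
  assumes "simple_graph (V, E)"
  shows "finite (triangles E)"
  by (rule finite_subset[of _ "V \<times> V \<times> V"])
    (auto simp: triangles_def assms simple_graph_finite[OF assms] dest: simple_graph_edgeD[OF assms])

lemma card_triangles:
  assumes "simple_graph (V, E)"
  shows "card (triangles E) = (\<Sum>v\<in>V. \<Sum>w\<in>nbhd E v. card (nbhd E v \<inter> nbhd E w))"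
proof -
  have "triangles E = (SIGMA v:V. SIGMA w:nbhd E v. nbhd E v \<inter> nbhd E w)"
    using simple_graph_edgeD[OF assms] by (auto simp: triangles_def insert_commute)
  then show ?thesis
    using simple_graph_finite[OF assms] by (simp add: finite_nbhd[OF assms])
qed

text \<open>Double counting of ordered adjacent pairs: \<open>w\<close> is the second entry once for
  each of its neighbors.\<close>

lemma sum_nbhd_swap:
  assumes "simple_graph (V, E)"
  shows "(\<Sum>v\<in>V. \<Sum>w\<in>nbhd E v. g w) = (\<Sum>w\<in>V. of_nat (card (nbhd E w)) * (g w :: int))"
proof -
  have eq: "nbhd E v = {w \<in> V. {v, w} \<in> E}" for v
    using simple_graph_edgeD[OF assms] by auto
  have "(\<Sum>v\<in>V. \<Sum>w\<in>nbhd E v. g w) = (\<Sum>w\<in>V. \<Sum>v\<in>{v \<in> V. {v, w} \<in> E}. g w)"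
    unfolding eq by (rule sum.swap_restrict) (simp_all add: simple_graph_finite[OF assms])
  also have "\<dots> = (\<Sum>w\<in>V. \<Sum>v\<in>nbhd E w. g w)"
    by (simp only: eq insert_commute)
  finally show ?thesis by simp
qed

text \<open>Inclusion-exclusion inside \<open>V\<close> bounds common neighbors from below. Summed
  over ordered adjacent pairs, the squared degree appears once from each end. Integers are used
  since the bound may be negative.\<close>

lemma degree_sum_le_triangles:
  assumes "simple_graph (V, E)"
  shows "(\<Sum>v\<in>V. int (card (nbhd E v)) * (2 * int (card (nbhd E v)) - int (card V)))
    \<le> int (card (triangles E))"
proof -
  let ?d = "\<lambda>v. int (card (nbhd E v))"
  have "?d v + ?d w - int (card V) \<le> int (card (nbhd E v \<inter> nbhd E w))" for v w
  proof -
    have "card (nbhd E v \<union> nbhd E w) \<le> card V"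
      by (rule card_mono) (use nbhd_subset[OF assms] simple_graph_finite[OF assms] in auto)
    then show ?thesis
      using card_Un_Int[OF finite_nbhd[OF assms] finite_nbhd[OF assms], of v w] by linarith
  qed
  then have "(\<Sum>v\<in>V. \<Sum>w\<in>nbhd E v. ?d v + ?d w - int (card V)) \<le> int (card (triangles E))"
    unfolding card_triangles[OF assms] of_nat_sum by (intro sum_mono)
  moreover have "(\<Sum>v\<in>V. \<Sum>w\<in>nbhd E v. ?d v + ?d w - int (card V))
    = (\<Sum>v\<in>V. ?d v * (?d v - int (card V))) + (\<Sum>v\<in>V. \<Sum>w\<in>nbhd E v. ?d w)"
    by (simp add: sum.distrib sum_subtractf algebra_simps)
  ultimately show ?thesis
    unfolding sum_nbhd_swap[OF assms] by (simp add: algebra_simps flip: sum.distrib)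
qed

section \<open>Upper bound without rainbow triangles\<close>

text \<open>Two edges of equal color in a triangle meet at a vertex, and a cyclic rotation brings
  that vertex to the front; hence the factor 3.\<close>

lemma card_triangles_le:
  assumes G: "simple_graph (V, E)" and nr: "\<not> has_rainbow_triangle (V, E) C"
  defines "ex \<equiv> \<lambda>v. card (nbhd E v) - color_degree (V, E) C v"
  shows "card (triangles E) \<le> 3 * (\<Sum>v\<in>V. ex v * (ex v + 1))"
proof -
  \<comment> \<open>\<open>?M\<close> has the equally colored edges meet at the first entry;
    \<open>?r\<close> and \<open>?s\<close> are mutually inverse rotations.\<close>
  let ?M = "{(x, y, z) \<in> triangles E. C {x, y} = C {x, z}}"
  let ?P = "\<lambda>v. {(u, w). u \<in> nbhd E v \<and> w \<in> nbhd E v \<and> u \<noteq> w \<and> C {v, u} = C {v, w}}"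
  let ?r = "\<lambda>(x, y, z). (y, z, x)" and ?s = "\<lambda>(x, y, z). (z, x, y)"
  have finM: "finite ?M" using finite_triangles[OF G] by (rule rev_finite_subset) auto
  have finP: "finite (?P v)" for v
    by (rule finite_subset[of _ "nbhd E v \<times> nbhd E v"]) (use finite_nbhd[OF G] in auto)
  have "t \<in> ?M \<union> ?r ` ?M \<union> ?s ` ?M" if t: "t \<in> triangles E" for t
  proof -
    obtain x y z where xyz: "t = (x, y, z)" by (cases t)
    then have E: "{x, y} \<in> E" "{y, z} \<in> E" "{x, z} \<in> E" using t by (auto simp: triangles_def)
    then have E': "{y, x} \<in> E" "{z, y} \<in> E" "{z, x} \<in> E" by (simp_all add: insert_commute)
    have "C {x, y} = C {y, z} \<or> C {y, z} = C {x, z} \<or> C {x, y} = C {x, z}"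
      using nr E unfolding has_rainbow_triangle_def by auto
    moreover have "{y, x} = {x, y}" "{z, x} = {x, z}" "{z, y} = {y, z}" by auto
    ultimately consider "C {x, y} = C {x, z}" | "C {y, z} = C {y, x}" | "C {z, x} = C {z, y}"
      by metis
    then show ?thesis
    proof cases
      case 1
      then show ?thesis using t xyz by auto
    next
      case 2
      then have "(y, z, x) \<in> ?M" using E E' by (auto simp: triangles_def)
      then have "?s (y, z, x) \<in> ?s ` ?M" by (rule imageI)
      then show ?thesis using xyz by simp
    next
      case 3
      then have "(z, x, y) \<in> ?M" using E E' by (auto simp: triangles_def)
      then have "?r (z, x, y) \<in> ?r ` ?M" by (rule imageI)
      then show ?thesis using xyz by simp
    qed
  qed
  then have "triangles E \<subseteq> ?M \<union> ?r ` ?M \<union> ?s ` ?M" by blast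
  then have "card (triangles E) \<le> card (?M \<union> ?r ` ?M \<union> ?s ` ?M)"
    using finM by (intro card_mono) auto
  also have "\<dots> \<le> card ?M + card (?r ` ?M) + card (?s ` ?M)"
    by (meson add_mono card_Un_le le_trans order.refl)
  also have "\<dots> \<le> card ?M + card ?M + card ?M"
    by (intro add_mono card_image_le finM order.refl)
  finally have "card (triangles E) \<le> 3 * card ?M" by simp
  \<comment> \<open>A triple in \<open>?M\<close> is a vertex with a colliding pair of neighbors.
    Adjacency of that pair is kept only as \<open>u \<noteq> w\<close>.\<close>
  also have "card ?M \<le> card (SIGMA v:V. ?P v)"
    using simple_graph_finite[OF G] finP
    by (intro card_mono) (auto simp: triangles_def dest: simple_graph_edgeD[OF G])
  also have "card (SIGMA v:V. ?P v) = (\<Sum>v\<in>V. card (?P v))"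
    using simple_graph_finite[OF G] finP by simp
  also have "\<dots> \<le> (\<Sum>v\<in>V. ex v * (ex v + 1))"
    unfolding ex_def color_degree_nbhd[OF G]
    by (intro sum_mono card_colliding_pairs_le finite_nbhd[OF G])
  finally show ?thesis by simp
qed

section \<open>The coloring is proper\<close>

text \<open>Comparing the two triangle bounds gives a sum of nonnegative terms that is at most 0, so
  every term vanishes; its second factor is positive wherever the excess is nonzero.\<close>

lemma color_degree_eq_degree:
  assumes G: "simple_graph (V, E)" and n: "card V \<noteq> 4"
    and dc: "\<And>v. v \<in> V \<Longrightarrow> card V \<le> 2 * color_degree (V, E) C v"
    and nr: "\<not> has_rainbow_triangle (V, E) C"
    and "v \<in> V"
  shows "color_degree (V, E) C v = card (nbhd E v)"
proof -
  let ?d = "\<lambda>v. int (card (nbhd E v))" and ?c = "\<lambda>v. int (color_degree (V, E) C v)"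
  let ?e = "\<lambda>v. ?d v - ?c v"
  have le: "?c v \<le> ?d v" for v by (simp add: color_degree_le_card_nbhd[OF G])
  have dc': "int (card V) \<le> 2 * ?c v" if "v \<in> V" for v
    using of_nat_mono[OF dc[OF that], where 'a=int] by simp
  have "(\<Sum>v\<in>V. ?d v * (2 * ?e v)) \<le> (\<Sum>v\<in>V. ?d v * (2 * ?d v - int (card V)))"
  proof (intro sum_mono mult_left_mono)
    fix v assume "v \<in> V"
    from dc'[OF this] show "2 * ?e v \<le> 2 * ?d v - int (card V)" by (simp add: algebra_simps)
  qed simp
  also have "\<dots> \<le> int (card (triangles E))" by (rule degree_sum_le_triangles[OF G])
  \<comment> \<open>The truncated difference of naturals becomes the integer \<open>?e v\<close>
    because the color degree never exceeds the degree.\<close>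
  also have "\<dots> \<le> 3 * (\<Sum>v\<in>V. ?e v * (?e v + 1))"
    using of_nat_mono[OF card_triangles_le[OF G nr], where 'a=int]
    by (simp add: of_nat_diff color_degree_le_card_nbhd[OF G] add.commute del: mult_Suc_right)
  finally have "(\<Sum>v\<in>V. ?d v * (2 * ?e v)) \<le> 3 * (\<Sum>v\<in>V. ?e v * (?e v + 1))" .
  \<comment> \<open>From \<open>e = d - c\<close> one gets
    \<open>2 d - 3 (e + 1) = 3 c - d - 3\<close>.\<close>
  moreover have "(\<Sum>v\<in>V. ?e v * (3 * ?c v - ?d v - 3))
      = (\<Sum>v\<in>V. ?d v * (2 * ?e v)) - 3 * (\<Sum>v\<in>V. ?e v * (?e v + 1))"
    unfolding sum_distrib_left sum_subtractf[symmetric]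
    by (rule sum.cong) (simp_all add: algebra_simps)
  ultimately have *: "(\<Sum>v\<in>V. ?e v * (3 * ?c v - ?d v - 3)) \<le> 0" by linarith
  \<comment> \<open>Here \<open>n/2 \<le> c \<le> d - 1 \<le> n - 2\<close> yields
    \<open>n \<ge> 4\<close>, hence \<open>n > 4\<close>, and
    \<open>3 c - d - 3 \<ge> 3 n/2 - (n - 1) - 3 = n/2 - 2 > 0\<close>. For \<open>n = 4\<close> the
    values \<open>c = 2\<close>, \<open>d = 3\<close> would give 0.\<close>
  have pos: "3 * ?c v - ?d v - 3 > 0" if "v \<in> V" "?e v \<noteq> 0" for v
    using card_nbhd_less[OF G that(1)] dc'[OF that(1)] le[of v] that(2) n by linarith
  have nonneg: "0 \<le> ?e v * (3 * ?c v - ?d v - 3)" if "v \<in> V" for v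
    using pos[OF that] le[of v] by (cases "?e v = 0") auto
  have "(\<Sum>v\<in>V. ?e v * (3 * ?c v - ?d v - 3)) = 0"
    by (rule antisym[OF * sum_nonneg]) (rule nonneg)
  then have "?e v * (3 * ?c v - ?d v - 3) = 0"
    using sum_nonneg_eq_0_iff[OF simple_graph_finite[OF G], of "\<lambda>v. ?e v * (3 * ?c v - ?d v - 3)"]
      nonneg \<open>v \<in> V\<close> by blast
  then show ?thesis using pos[OF \<open>v \<in> V\<close>] by fastforce
qed

text \<open>Equality makes the coloring injective on the edges at each vertex. Any two edges of a
  triangle share a vertex, so a triangle would be rainbow.\<close>

lemma triangle_free_if_proper:
  assumes G: "simple_graph (V, E)" and nr: "\<not> has_rainbow_triangle (V, E) C"
    and proper: "\<And>v. v \<in> V \<Longrightarrow> color_degree (V, E) C v = card (nbhd E v)"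
  shows "triangles E = {}"
proof -
  have inj: "inj_on (\<lambda>w. C {v, w}) (nbhd E v)" if "v \<in> V" for v
    using proper[OF that] by (simp add: color_degree_nbhd[OF G] eq_card_imp_inj_on finite_nbhd[OF G])
  have ne: "C {v, u} \<noteq> C {v, w}" if "{v, u} \<in> E" "{v, w} \<in> E" "{u, w} \<in> E" for u v w
    using inj_onD[OF inj, of v u w] that simple_graph_edgeD[OF G] by auto
  have False if "{x, y} \<in> E" "{y, z} \<in> E" "{x, z} \<in> E" for x y z
  proof -
    have "{y, x} = {x, y}" "{z, x} = {x, z}" "{z, y} = {y, z}" by auto
    then have "C {x, y} \<noteq> C {x, z}" "C {x, y} \<noteq> C {y, z}" "C {y, z} \<noteq> C {x, z}"
      using that ne[of x y z] ne[of y x z] ne[of z x y] by metis+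
    then show False
      using nr that unfolding has_rainbow_triangle_def by auto
  qed
  then show ?thesis by (auto simp: triangles_def)
qed

section \<open>Recognizing complete bipartite graphs\<close>

lemma graph_isoI:
  assumes "bij_betw f V W"
    and "\<And>u v. u \<in> V \<Longrightarrow> v \<in> V \<Longrightarrow> {u, v} \<in> E \<longleftrightarrow> {f u, f v} \<in> F"
  shows "(V, E) \<simeq>\<^sub>g (W, F)"
  unfolding graph_iso_def fst_conv snd_conv using assms by blast

text \<open>Bijections of the two sides are glued into one. The independence hypotheses include
  \<open>u = v\<close> and so exclude loops.\<close>

lemma iso_complete_bipartiteI:
  assumes V: "V = A \<union> B" "A \<inter> B = {}" and fin: "finite A" "finite B"
    and card: "card A = a" "card B = b"
    and AB: "\<And>u v. u \<in> A \<Longrightarrow> v \<in> B \<Longrightarrow> {u, v} \<in> E"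
    and AA: "\<And>u v. u \<in> A \<Longrightarrow> v \<in> A \<Longrightarrow> {u, v} \<notin> E"
    and BB: "\<And>u v. u \<in> B \<Longrightarrow> v \<in> B \<Longrightarrow> {u, v} \<notin> E"
  shows "(V, E) \<simeq>\<^sub>g complete_bipartite_graph a b"
proof -
  obtain g h where g: "bij_betw g A {..<a}" and h: "bij_betw h B {..<b}"
    using fin card by (metis atLeast0LessThan ex_bij_betw_finite_nat)
  let ?f = "\<lambda>u. if u \<in> A then Inl (g u) else Inr (h u)"
  have "bij_betw ?f V ({..<a} <+> {..<b})"
    unfolding bij_betw_def
  proof
    show "inj_on ?f V"
      using g h V by (auto simp: inj_on_def bij_betw_def)
    have "?f ` A = Inl ` g ` A" "?f ` B = Inr ` h ` B"
      unfolding image_image by (rule image_cong; use V(2) in auto)+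
    then show "?f ` V = {..<a} <+> {..<b}"
      unfolding V(1) image_Un Plus_def
        bij_betw_imp_surj_on[OF g, symmetric] bij_betw_imp_surj_on[OF h, symmetric] by simp
  qed
  moreover have "{u, v} \<in> E \<longleftrightarrow> {?f u, ?f v} \<in> snd (complete_bipartite_graph a b)"
    if "u \<in> V" "v \<in> V" for u v
  proof -
    have mem: "g u < a" if "u \<in> A" for u using g that by (auto simp: bij_betw_def)
    have mem': "h u < b" if "u \<in> B" for u using h that by (auto simp: bij_betw_def)
    have BA: "{u, v} \<in> E" if "u \<in> B" "v \<in> A" for u v
      using AB[OF that(2,1)] by (simp add: insert_commute)
    show ?thesis
      using that V AB AA BB BA mem mem'
      by (auto simp: complete_bipartite_graph_def doubleton_eq_iff)
  qed
  ultimately show ?thesis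
    unfolding complete_bipartite_graph_def snd_conv by (rule graph_isoI)
qed

text \<open>The ends of an edge have disjoint neighborhoods, each at least half of \<open>V\<close>,
  so these split \<open>V\<close> into halves. Both are independent, and the degree bound forces all
  edges between them.\<close>

lemma triangle_free_iso_complete_bipartite:
  assumes G: "simple_graph (V, E)" and tf: "triangles E = {}"
    and deg: "\<And>v. v \<in> V \<Longrightarrow> card V \<le> 2 * card (nbhd E v)"
  shows "even (card V) \<and> (V, E) \<simeq>\<^sub>g complete_bipartite_graph (card V div 2) (card V div 2)"
proof (cases "V = {}")
  case True
  \<comment> \<open>The empty graph has two empty sides; otherwise the degree bound provides an
    edge.\<close>
  then show ?thesis by (auto intro!: iso_complete_bipartiteI[of _ "{}" "{}"])
next
  case False
  then obtain v where v: "v \<in> V" by blast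
  have fin: "finite V" by (rule simple_graph_finite[OF G])
  have "0 < card V" using v fin card_gt_0_iff by blast
  then have "card (nbhd E v) \<noteq> 0" using deg[OF v] by linarith
  then obtain w where vw: "{v, w} \<in> E" by (metis card.empty ex_in_conv in_nbhd)
  have w: "w \<in> V" by (rule simple_graph_edgeD(2)[OF G vw])
  have indep: "{x, y} \<notin> E" if "{u, x} \<in> E" "{u, y} \<in> E" for u x y
    using tf that by (auto simp: triangles_def)
  have disj: "nbhd E x \<inter> nbhd E y = {}" if "{x, y} \<in> E" for x y
    using indep[of _ x y] that by (auto simp: insert_commute)
  \<comment> \<open>The names are crossed so that \<open>v\<close> lies in \<open>?A\<close> and
    \<open>w\<close> in \<open>?B\<close>.\<close>
  let ?A = "nbhd E w" and ?B = "nbhd E v"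
  have sub: "nbhd E u \<subseteq> V" for u using nbhd_subset[OF G, of u] by blast
  have "?A \<inter> ?B = {}" using disj[OF vw] by blast
  then have "card ?A + card ?B = card (?A \<union> ?B)"
    by (simp add: card_Un_disjoint finite_nbhd[OF G])
  also have "\<dots> \<le> card V" by (intro card_mono fin) (use sub in auto)
  finally have c: "card V = 2 * card ?A" "card ?A = card ?B"
    using deg[OF v] deg[OF w] by auto
  have "card (?A \<union> ?B) = card V"
    using c \<open>card ?A + card ?B = card (?A \<union> ?B)\<close> by simp
  then have V: "V = ?A \<union> ?B"
    using sub card_subset_eq[OF fin, of "?A \<union> ?B"] by blast
  \<comment> \<open>As \<open>x\<close> is adjacent to \<open>w\<close>, its neighborhood avoids
    \<open>?A\<close>; the degree bound then makes it fill \<open>?B\<close>.\<close>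
  have full: "nbhd E x = ?B" if x: "x \<in> ?A" for x
  proof (rule card_subset_eq)
    show "finite ?B" by (rule finite_nbhd[OF G])
    show sub': "nbhd E x \<subseteq> ?B"
      using V sub disj[of w x] x by auto
    have "x \<in> V" using x sub by blast
    then show "card (nbhd E x) = card ?B"
      using deg[of x] c card_mono[OF \<open>finite ?B\<close> sub'] by linarith
  qed
  have "(V, E) \<simeq>\<^sub>g complete_bipartite_graph (card V div 2) (card V div 2)"
  proof (rule iso_complete_bipartiteI[OF V \<open>?A \<inter> ?B = {}\<close> finite_nbhd[OF G] finite_nbhd[OF G]])
    show "card ?A = card V div 2" "card ?B = card V div 2" using c by simp_all
    show "{x, y} \<in> E" if "x \<in> ?A" "y \<in> ?B" for x y
      using full[OF that(1)] that(2) by (metis in_nbhd)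
    show "{x, y} \<notin> E" if "x \<in> ?A" "y \<in> ?A" for x y
      using indep[of w x y] that by simp
    show "{x, y} \<notin> E" if "x \<in> ?B" "y \<in> ?B" for x y
      using indep[of v x y] that by simp
  qed
  then show ?thesis using c(1) by simp
qed

section \<open>Graphs on four vertices\<close>

lemma iso_complete_graphI:
  assumes G: "simple_graph (V, E)" and "card V = n"
    and complete: "\<And>u v. u \<in> V \<Longrightarrow> v \<in> V \<Longrightarrow> u \<noteq> v \<Longrightarrow> {u, v} \<in> E"
  shows "(V, E) \<simeq>\<^sub>g complete_graph n"
proof -
  obtain f where f: "bij_betw f V {..<n}"
    using simple_graph_finite[OF G] assms(2) by (metis atLeast0LessThan ex_bij_betw_finite_nat)
  have "{u, v} \<in> E \<longleftrightarrow> {f u, f v} \<in> [{..<n}]\<^bsup>2\<^esup>" if "u \<in> V" "v \<in> V" for u v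
  proof -
    have "f u < n" "f v < n" "f u = f v \<longleftrightarrow> u = v"
      using f that by (auto simp: bij_betw_def inj_on_def)
    then show ?thesis
      using complete[OF that] simple_graph_edgeD(3)[OF G, of u v]
      by (auto simp: nsets_def card_insert_if)
  qed
  with f show ?thesis unfolding complete_graph_def by (rule graph_isoI)
qed

lemma iso_K4_minus_edgeI:
  assumes G: "simple_graph (V, E)" and V: "V = {a, b, c, d}" "distinct [a, b, c, d]"
    and "{a, b} \<notin> E" "{a, c} \<in> E" "{a, d} \<in> E" "{b, c} \<in> E" "{b, d} \<in> E" "{c, d} \<in> E"
  shows "(V, E) \<simeq>\<^sub>g K4_minus_edge"
proof -
  \<comment> \<open>The nonadjacent pair \<open>a\<close>, \<open>b\<close> must go to the ends 0
    and 1 of the deleted edge.\<close>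
  let ?f = "\<lambda>x. if x = a then 0 else if x = b then 1 else if x = c then 2 else 3 :: nat"
  have "bij_betw ?f V {..<4}"
    using V by (auto simp: bij_betw_def inj_on_def lessThan_nat_numeral lessThan_Suc numeral_eq_Suc)
  moreover have "{u, v} \<in> E \<longleftrightarrow> {?f u, ?f v} \<in> [{..<4}]\<^bsup>2\<^esup> - {{0, 1}}"
    if "u \<in> V" "v \<in> V" for u v
  proof -
    have "{x} \<notin> E" for x using simple_graph_edgeD(3)[OF G, of x x] by auto
    then show ?thesis
      using that V assms(4-9)
      by (auto simp: nsets_def card_insert_if doubleton_eq_iff insert_commute)
  qed
  ultimately show ?thesis
    unfolding K4_minus_edge_def complete_graph_def fst_conv snd_conv by (rule graph_isoI)
qed

text \<open>The degree bound joins each vertex of a nonadjacent pair to both remaining vertices.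
  Only the edge between those two is open; without it the graph is a 4-cycle.\<close>

lemma four_vertices_min_degree_two:
  assumes G: "simple_graph (V, E)" and n: "card V = 4"
    and deg: "\<And>v. v \<in> V \<Longrightarrow> 2 \<le> card (nbhd E v)"
  shows "(V, E) \<simeq>\<^sub>g complete_bipartite_graph 2 2 \<or> (V, E) \<simeq>\<^sub>g K4_minus_edge \<or>
    (V, E) \<simeq>\<^sub>g complete_graph 4"
proof (cases "\<forall>u\<in>V. \<forall>v\<in>V. u \<noteq> v \<longrightarrow> {u, v} \<in> E")
  case True
  then show ?thesis using iso_complete_graphI[OF G n] by blast
next
  case False
  then obtain a b where ab: "a \<in> V" "b \<in> V" "a \<noteq> b" "{a, b} \<notin> E" by blast
  have fin: "finite V" by (rule simple_graph_finite[OF G])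
  have "card (V - {a, b}) = 2" using ab n fin by (simp add: card_Diff_subset)
  then obtain c d where cd: "V - {a, b} = {c, d}" "c \<noteq> d" by (auto simp: card_2_iff)
  have V: "V = {a, b, c, d}" "distinct [a, b, c, d]" using cd ab by auto
  have nb: "nbhd E x = {c, d}" if x: "x \<in> {a, b}" for x
  proof (rule card_seteq)
    have "{b, a} \<notin> E" using ab(4) by (simp add: insert_commute)
    then show "nbhd E x \<subseteq> {c, d}"
      using nbhd_subset[OF G, of x] x ab(4) V(1) by auto
    show "card {c, d} \<le> card (nbhd E x)" using deg[of x] x ab cd(2) by auto
  qed simp
  have e: "{a, c} \<in> E" "{a, d} \<in> E" "{b, c} \<in> E" "{b, d} \<in> E"
    using nb[of a] nb[of b] by auto
  show ?thesis
  proof (cases "{c, d} \<in> E")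
    case True
    then show ?thesis using iso_K4_minus_edgeI[OF G V ab(4) e] by blast
  next
    case False
    have loop: "{x} \<notin> E" for x using simple_graph_edgeD(3)[OF G, of x x] by auto
    have "(V, E) \<simeq>\<^sub>g complete_bipartite_graph 2 2"
      by (rule iso_complete_bipartiteI[of _ "{a, b}" "{c, d}"])
        (use V e False ab(4) loop in \<open>auto simp: insert_commute\<close>)
    then show ?thesis by blast
  qed
qed

theorem theorem3:
  fixes V :: "'a set" and E :: "'a set set" and C :: "'a set \<Rightarrow> nat" and n :: nat
  assumes "simple_graph (V, E)" and "card V = n"
    and "\<And>v. v \<in> V \<Longrightarrow> real (color_degree (V, E) C v) \<ge> real n / 2"
    and "\<not> has_rainbow_triangle (V, E) C"
  shows "(even n \<and> (V, E) \<simeq>\<^sub>g complete_bipartite_graph (n div 2) (n div 2))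
    \<or> (n = 4 \<and> ((V, E) \<simeq>\<^sub>g K4_minus_edge \<or> (V, E) \<simeq>\<^sub>g complete_graph 4))"
proof -
  have dc: "card V \<le> 2 * color_degree (V, E) C v" if "v \<in> V" for v
    using assms(2) assms(3)[OF that] by linarith
  have deg: "card V \<le> 2 * card (nbhd E v)" if "v \<in> V" for v
    using dc[OF that] color_degree_le_card_nbhd[OF assms(1), of C v] by linarith
  show ?thesis
  proof (cases "n = 4")
    case True
    have "2 \<le> card (nbhd E v)" if "v \<in> V" for v
      using deg[OF that] True assms(2) by linarith
    then show ?thesis
      using four_vertices_min_degree_two[OF assms(1)] True assms(2) by auto
  next
    case False
    then have "triangles E = {}"
      using triangle_free_if_proper[OF assms(1,4)] color_degree_eq_degree[OF assms(1) _ dc assms(4)]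
        assms(2) by blast
    then show ?thesis
      using triangle_free_iso_complete_bipartite[OF assms(1) _ deg] assms(2) by blast
  qed
qed

end
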